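(* Let $s\ge1$, let $w=(x_1,\dots,x_n)\in\mathcal I_n$ with set of distinct entries $\{y_1<\dots<y_k\}$, put $y_{k+1}=n$, and let $A=\Phi(w)$. Then $A$ is $s$-diagonal if and only if for every $i\in[1,n]$ there exists $a(i)\in[1,k]$ such that $$y_{a(i)}<i\le y_{a(i)+1}\quad\text{and}\quad x_i\in\{y_{a(i)},y_{a(i)-1},\dots,y_{\max(1,a(i)-s+1)}\}.$$
   Context: $[a,b]=\{i\in\mathbb Z:a\le i\le b\}$. $\mathcal I_n$ is the set of integer sequences $(x_1,\dots,x_n)$ with $0\le x_\ell\le\ell-1$. For $w\in\mathcal I_n$ with distinct entries $y_1<\dots<y_k$ and $y_{k+1}:=n$, $\Phi(w)$ is the $k\times k$ matrix whose $(i,j)$ entry is $\{\ell\in[1,n]: x_\ell=y_i\text{ and }y_j<\ell\le y_{j+1}\}$. A $k\times k$ matrix $A$ with set entries is $s$-diagonal if it is upper triangular and $A_{ij}=\emptyset$ whenever $j-i\ge s$. *)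

theory Defs
  imports Main "HOL-Library.FuncSet"
begin

text \<open>Sequences \<open>(x\<^sub>1, \<dots>, x\<^sub>n)\<close> are functions on the index set \<open>{1..n}\<close>; as the entries are
  nonnegative, they are taken in \<^typ>\<open>nat\<close>.\<close>

definition inv_seqs :: "nat \<Rightarrow> (nat \<Rightarrow> nat) set" where
  "inv_seqs n = (\<Pi>\<^sub>E l\<in>{1..n}. {0..l - 1})"

definition num_distinct :: "nat \<Rightarrow> (nat \<Rightarrow> nat) \<Rightarrow> nat" where
  "num_distinct n x = card (x ` {1..n})"

text \<open>The 1-indexed increasing enumeration \<open>y\<^sub>1 < \<dots> < y\<^sub>k\<close> of the distinct entries of \<open>x\<close>,
  extended by \<open>y\<^sub>k\<^sub>+\<^sub>1 = n\<close>. Only the indices \<open>1, \<dots>, k + 1\<close> are meaningful.\<close>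

definition distinct_entry :: "nat \<Rightarrow> (nat \<Rightarrow> nat) \<Rightarrow> nat \<Rightarrow> nat" where
  "distinct_entry n x i =
     (if i = num_distinct n x + 1 then n else sorted_list_of_set (x ` {1..n}) ! (i - 1))"

text \<open>A \<open>k \<times> k\<close> matrix is a function of a row index and a column index, both in \<open>{1..k}\<close>. For \<open>Phi n x\<close>
  the size is \<open>k = num_distinct n x\<close>.\<close>

definition Phi :: "nat \<Rightarrow> (nat \<Rightarrow> nat) \<Rightarrow> nat \<Rightarrow> nat \<Rightarrow> nat set" where
  "Phi n x i j =
     {l \<in> {1..n}. x l = distinct_entry n x i \<and>
        distinct_entry n x j < l \<and> l \<le> distinct_entry n x (j + 1)}"

definition upper_triangular_sets :: "nat \<Rightarrow> (nat \<Rightarrow> nat \<Rightarrow> 'a set) \<Rightarrow> bool" where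
  "upper_triangular_sets k A \<longleftrightarrow> (\<forall>i\<in>{1..k}. \<forall>j\<in>{1..k}. j < i \<longrightarrow> A i j = {})"

definition s_diagonal :: "nat \<Rightarrow> nat \<Rightarrow> (nat \<Rightarrow> nat \<Rightarrow> 'a set) \<Rightarrow> bool" where
  "s_diagonal s k A \<longleftrightarrow>
     upper_triangular_sets k A \<and>
     (\<forall>i\<in>{1..k}. \<forall>j\<in>{1..k}. int j - int i \<ge> int s \<longrightarrow> A i j = {})"

lemma distinct_entry_image:
  "distinct_entry n x ` {1..num_distinct n x} = x ` {1..n}"
proof -
  let ?L = "sorted_list_of_set (x ` {1..n})"
  have "distinct_entry n x ` {1..num_distinct n x} = (\<lambda>i. ?L ! (i - 1)) ` Suc ` {0..<length ?L}"
    by (intro image_cong) (auto simp: distinct_entry_def num_distinct_def image_Suc_atLeastLessThan)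
  also have "\<dots> = set ?L"
    unfolding image_image by (auto simp only: set_conv_nth diff_Suc_1 image_iff Bex_def
      atLeastLessThan_iff mem_Collect_eq)
  finally show ?thesis by simp
qed

lemma strict_mono_on_distinct_entry:
  "strict_mono_on {1..num_distinct n x} (distinct_entry n x)"
proof (rule strict_mono_onI)
  fix i j assume ij: "i \<in> {1..num_distinct n x}" "j \<in> {1..num_distinct n x}" "i < j"
  have "sorted_list_of_set (x ` {1..n}) ! (i - 1) < sorted_list_of_set (x ` {1..n}) ! (j - 1)"
    using ij by (intro sorted_wrt_nth_less[OF strict_sorted_list_of_set])
      (auto simp: num_distinct_def)
  then show "distinct_entry n x i < distinct_entry n x j"
    using ij by (auto simp: distinct_entry_def)
qed

end

theory Submission
  imports Defs
begin

text \<open>Since \<open>x\<^sub>1 = 0\<close> and all entries are smaller than \<open>n\<close>, the intervals \<open>(y\<^sub>a, y\<^sub>a\<^sub>+\<^sub>1]\<close> for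
  \<open>1 \<le> a \<le> k\<close> partition \<open>[1,n]\<close>. Hence every \<open>l\<close> lies in exactly one entry \<open>A\<^sub>b\<^sub>a\<close>, where
  \<open>x\<^sub>l = y\<^sub>b\<close> and \<open>y\<^sub>a < l \<le> y\<^sub>a\<^sub>+\<^sub>1\<close>, and \<open>s\<close>-diagonality says that \<open>a - s < b \<le> a\<close> for each \<open>l\<close>.\<close>

text \<open>Only comparisons with the appended value \<open>n\<close> are new: every entry satisfies
  \<open>x l \<le> l - 1 < n\<close>.\<close>

lemma strict_mono_on_distinct_entry_Suc:
  assumes "x \<in> inv_seqs n"
  shows "strict_mono_on {1..num_distinct n x + 1} (distinct_entry n x)"
proof (rule strict_mono_onI)
  let ?y = "distinct_entry n x" and ?k = "num_distinct n x"
  fix i j assume ij: "i \<in> {1..?k + 1}" "j \<in> {1..?k + 1}" "i < j"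
  show "?y i < ?y j"
  proof (cases "j = ?k + 1")
    case True
    with ij have "?y i \<in> x ` {1..n}"
      using distinct_entry_image[of n x] by auto
    then obtain l where "l \<in> {1..n}" "?y i = x l" by auto
    moreover from this assms have "x l \<le> l - 1"
      by (auto simp: inv_seqs_def)
    ultimately have "?y i < n" by auto
    with True show ?thesis by (simp add: distinct_entry_def)
  next
    case False
    with ij show ?thesis
      by (intro strict_mono_onD[OF strict_mono_on_distinct_entry]) auto
  qed
qed

text \<open>The bound \<open>x l \<le> l - 1\<close> forces \<open>x 1 = 0\<close>, so 0 is an
  entry; nothing in \<open>nat\<close> lies below it, so it comes first in the enumeration.\<close>

lemma distinct_entry_first:
  assumes "x \<in> inv_seqs n" "n \<ge> 1"
  shows "num_distinct n x \<ge> 1" "distinct_entry n x 1 = 0"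
proof -
  from assms have "x 1 = 0" by (force simp: inv_seqs_def)
  then have "0 \<in> x ` {1..n}" using assms(2) by force
  then obtain a where a: "a \<in> {1..num_distinct n x}" "distinct_entry n x a = 0"
    by (metis distinct_entry_image imageE)
  then show "num_distinct n x \<ge> 1" by simp
  show "distinct_entry n x 1 = 0"
  proof (cases "a = 1")
    case False
    with a have "distinct_entry n x 1 < distinct_entry n x a"
      by (intro strict_mono_onD[OF strict_mono_on_distinct_entry]) auto
    with a show ?thesis by simp
  qed (use a in simp)
qed

lemma distinct_entry_interval_exists:
  assumes "x \<in> inv_seqs n" "l \<in> {1..n}"
  obtains a where "a \<in> {1..num_distinct n x}"
    "distinct_entry n x a < l" "l \<le> distinct_entry n x (a + 1)"
proof -
  let ?y = "distinct_entry n x" and ?k = "num_distinct n x"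
  \<comment> \<open>The wanted index is the largest \<open>a\<close> with \<open>?y a < l\<close>;
    index 1 qualifies because \<open>?y 1 = 0 < l\<close>.\<close>
  define S where "S = {a \<in> {1..?k}. ?y a < l}"
  have "finite S" by (simp add: S_def)
  moreover have "1 \<in> S"
    using distinct_entry_first[of x n] assms by (auto simp: S_def)
  ultimately have M: "Max S \<in> S" "\<And>a. a \<in> S \<Longrightarrow> a \<le> Max S"
    by (auto intro: Max_in)
  have "l \<le> ?y (Max S + 1)"
  \<comment> \<open>At the last index the right endpoint is \<open>n\<close> by convention;
    otherwise \<open>Max S + 1\<close> is a legal index outside \<open>S\<close>.\<close>
  proof (cases "Max S = ?k")
    case True
    then show ?thesis using assms(2) by (simp add: distinct_entry_def)
  next
    case False
    then have "Max S + 1 \<in> {1..?k}" using M(1) by (auto simp: S_def)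
    moreover have "Max S + 1 \<notin> S" using M(2) by force
    ultimately show ?thesis by (auto simp: S_def)
  qed
  with M(1) that show ?thesis by (auto simp: S_def)
qed

text \<open>For indices \<open>i < j\<close>, membership of \<open>l\<close> in both intervals would
  give \<open>l \<le> y (i + 1) \<le> y j < l\<close>.\<close>

lemma distinct_entry_interval_unique:
  assumes "x \<in> inv_seqs n"
    and "a \<in> {1..num_distinct n x}" "distinct_entry n x a < l" "l \<le> distinct_entry n x (a + 1)"
    and "b \<in> {1..num_distinct n x}" "distinct_entry n x b < l" "l \<le> distinct_entry n x (b + 1)"
  shows "a = b"
proof -
  have "\<not> i < j"
    if "i \<in> {1..num_distinct n x}" "j \<in> {1..num_distinct n x}"
      "distinct_entry n x j < l" "l \<le> distinct_entry n x (i + 1)" for i j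
  proof
    assume "i < j"
    with that have "distinct_entry n x (i + 1) \<le> distinct_entry n x j"
      by (intro strict_mono_on_leD[OF strict_mono_on_distinct_entry_Suc[OF assms(1)]]) auto
    with that show False by simp
  qed
  with assms show ?thesis by (meson linorder_neqE_nat)
qed

theorem theorem10:
  fixes n s k :: nat and x y :: "nat \<Rightarrow> nat" and A :: "nat \<Rightarrow> nat \<Rightarrow> nat set"
  assumes "s \<ge> 1"
    and "x \<in> inv_seqs n"
    and "k = num_distinct n x"
    and "y = distinct_entry n x"
    and "A = Phi n x"
  shows "s_diagonal s k A \<longleftrightarrow>
    (\<forall>i\<in>{1..n}. \<exists>a\<in>{1..k}.
       y a < i \<and> i \<le> y (a + 1) \<and>
       x i \<in> {y b |b. max 1 (int a - int s + 1) \<le> int b \<and> b \<le> a})"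
proof
  assume diag: "s_diagonal s k A"
  show "\<forall>i\<in>{1..n}. \<exists>a\<in>{1..k}. y a < i \<and> i \<le> y (a + 1) \<and>
       x i \<in> {y b |b. max 1 (int a - int s + 1) \<le> int b \<and> b \<le> a}"
  proof
    fix i assume i: "i \<in> {1..n}"
    obtain a where a: "a \<in> {1..k}" "y a < i" "i \<le> y (a + 1)"
      using distinct_entry_interval_exists[OF assms(2) i] assms(3,4) by metis
    have "x i \<in> y ` {1..k}"
      using i distinct_entry_image[of n x] assms(3,4) by simp
    then obtain b where b: "b \<in> {1..k}" "x i = y b" by auto
    \<comment> \<open>The value of \<open>x i\<close> fixes the row \<open>b\<close>, the position
      \<open>i\<close> fixes the column \<open>a\<close>. This entry is nonempty, so it can lie
      neither below the diagonal nor \<open>s\<close> or more places to its right.\<close>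
    have "i \<in> A b a"
      using i a b assms by (simp add: Phi_def)
    then have "\<not> a < b" "\<not> int s \<le> int a - int b"
      using diag a(1) b(1) unfolding s_diagonal_def upper_triangular_sets_def by auto
    then have "x i \<in> {y b |b. max 1 (int a - int s + 1) \<le> int b \<and> b \<le> a}"
      using b by (intro CollectI exI[of _ b]) auto
    with a show "\<exists>a\<in>{1..k}. y a < i \<and> i \<le> y (a + 1) \<and>
       x i \<in> {y b |b. max 1 (int a - int s + 1) \<le> int b \<and> b \<le> a}" by blast
  qed
next
  assume ex: "\<forall>i\<in>{1..n}. \<exists>a\<in>{1..k}. y a < i \<and> i \<le> y (a + 1) \<and>
       x i \<in> {y b |b. max 1 (int a - int s + 1) \<le> int b \<and> b \<le> a}"
  \<comment> \<open>Contrapositive form of \<open>s\<close>-diagonality: a nonempty entry lies in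
    the band.\<close>
  have band: "i \<le> j \<and> int j - int i < int s"
    if ij: "i \<in> {1..k}" "j \<in> {1..k}" and l: "l \<in> A i j" for i j l
  proof -
    have l': "l \<in> {1..n}" "x l = y i" "y j < l" "l \<le> y (j + 1)"
      using l assms by (auto simp: Phi_def)
    obtain a b where a: "a \<in> {1..k}" "y a < l" "l \<le> y (a + 1)"
      and b: "x l = y b" "max 1 (int a - int s + 1) \<le> int b" "b \<le> a"
      using ex l'(1) by blast
    have "a = j"
      using distinct_entry_interval_unique[OF assms(2)] a ij(2) l' assms(3,4) by blast
    \<comment> \<open>The bounds \<open>1 \<le> b \<le> a \<le> k\<close> put \<open>b\<close> in
      the range where \<open>y\<close> is injective, and \<open>y b = x l = y i\<close>.\<close>
    moreover have "b = i"
      using strict_mono_on_imp_inj_on[OF strict_mono_on_distinct_entry[of n x]]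
        a(1) b ij(1) l'(2) assms(3,4) by (auto dest: inj_onD)
    ultimately show ?thesis using b by auto
  qed
  show "s_diagonal s k A"
    unfolding s_diagonal_def upper_triangular_sets_def
  proof (intro conjI ballI impI)
    fix i j assume "i \<in> {1..k}" "j \<in> {1..k}" "j < i"
    with band[of i j] show "A i j = {}" by (meson equals0I not_le)
  next
    fix i j assume "i \<in> {1..k}" "j \<in> {1..k}" "int s \<le> int j - int i"
    with band[of i j] show "A i j = {}" by (meson equals0I not_le)
  qed
qed

end
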